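(* Consider the nonlinear system $x_{k+1}=\varphi_k(x_k,w_k)$, $y_{k+1}=\gamma_{k+1}(x_{k+1})+v_{k+1}$ described in the context. When $z_{k+1}=y_{1:k+1}A_{k+1}$, $\beta_{k+1}=v_{1:k+1}A_{k+1}$ and the probability density function $p_{\beta_{k+1}}(\beta_{k+1})$ of $\beta_{k+1}$ are known, the mean and variance of $x_{k+1}$ (given $z_{k+1}$) can be expressed as $$\hat x_{k+1|z_{k+1}}=\int_{-\infty}^{+\infty}p_{x_{k+1}|z_{k+1}}(x_{k+1}\mid z_{k+1})\,x_{k+1}\,dx_{k+1}=\frac{\displaystyle\int_{-\infty}^{+\infty} p_{x_0}(x_0)\,p_{w_{0:k}}(w_{0:k})\,\varphi_k(x_k,w_k)\,p_{\beta_{k+1}}\big(z_{k+1}-\gamma_{1:k+1}(x_{1:k+1})A_{k+1}\big)\,dx_0\,dw_{0:k}}{\displaystyle\int_{-\infty}^{+\infty} p_{x_0}(x_0)\,p_{w_{0:k}}(w_{0:k})\,p_{\beta_{k+1}}\big(z_{k+1}-\gamma_{1:k+1}(x_{1:k+1})A_{k+1}\big)\,dx_0\,dw_{0:k}}$$ and $$\begin{aligned}P_{k+1|z_{k+1}}&=\int_{-\infty}^{+\infty}p_{x_{k+1}|z_{k+1}}(x_{k+1}\mid z_{k+1})\,(x_{k+1}-\hat x_{k+1|z_{k+1}})(x_{k+1}-\hat x_{k+1|z_{k+1}})^{\mathrm T}\,dx_{k+1}\\&=\frac{\displaystyle\int_{-\infty}^{+\infty} p_{x_0}(x_0)\,p_{w_{0:k}}(w_{0:k})\,p_{\beta_{k+1}}\big(z_{k+1}-\gamma_{1:k+1}(x_{1:k+1})A_{k+1}\big)\big(\varphi_k(x_k,w_k)-\hat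 x_{k+1|z_{k+1}}\big)\big(\varphi_k(x_k,w_k)-\hat x_{k+1|z_{k+1}}\big)^{\mathrm T}\,dx_0\,dw_{0:k}}{\displaystyle\int_{-\infty}^{+\infty} p_{x_0}(x_0)\,p_{w_{0:k}}(w_{0:k})\,p_{\beta_{k+1}}\big(z_{k+1}-\gamma_{1:k+1}(x_{1:k+1})A_{k+1}\big)\,dx_0\,dw_{0:k}}.\end{aligned}$$
   Context: Here $x_k$ is the (vector) state at time $k$, $y_{k+1}$ the (vector) measurement at time $k+1$, $\varphi_k$ the nonlinear state transition function, $\gamma_{k+1}$ the nonlinear measurement function, and $w_k$, $v_{k+1}$ are zero mean process noise and measurement noise. The initial state $x_0$ has probability density function $p_{x_0}$; the joint probability density functions of $w_{0:k}=(w_0,w_1,\dots,w_k)$ and $v_{1:k+1}=(v_1,v_2,\dots,v_{k+1})$ are $p_{w_{0:k}}$ and $p_{v_{1:k+1}}$. The noise is not assumed to be Gaussian white noise. Write $y_{1:k+1}=(y_1,\dots,y_{k+1})$ and $\gamma_{1:k+1}(x_{1:k+1})=(\gamma_1(x_1),\dots,\gamma_{k+1}(x_{k+1}))$; these tuples and $v_{1:k+1}$ are regarded as matrices whose columns are the listed vectors. $A_{k+1}$ is an operator, acting by multiplication on the right, that extracts from $y_{1:k+1}$ the measurements that are key for estimating $x_{k+1}$; for example, the $0$-$1$ matrix whose two columns are the last two standard basis vectors gives $z_{k+1}=(y_k,y_{k+1})$. The quantity $\beta_{k+1}$ is the measurement error of $z_{k+1}$, and $p_{x_{k+1}|z_{k+1}}$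 is the conditional probability density function of $x_{k+1}$ given $z_{k+1}$. The integrals in the quotients are over all values of $(x_0,w_{0:k})$, and the states appearing in them are the functions of $(x_0,w_{0:k})$ determined by the recursion $x_{i+1}=\varphi_i(x_i,w_i)$.
   Formalization: The initial state x_0, the process noise w_{0:k} and the measurement noise v_{1:k+1} are assumed mutually independent (the formulas fail for correlated w and v); the formulas are claimed for almost every value of z_{k+1}, with measurable φ and γ. *)

theory Defs
  imports "HOL-Probability.Probability"
begin

definition has_pdf :: "'a measure \<Rightarrow> 'b measure \<Rightarrow> ('a \<Rightarrow> 'b) \<Rightarrow> ('b \<Rightarrow> real) \<Rightarrow> bool" where
  "has_pdf M N X p \<longleftrightarrow> (\<forall>x\<in>space N. 0 \<le> p x) \<and> distributed M N X (\<lambda>x. ennreal (p x))"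

text \<open>The value of a conditional density is left unconstrained where the marginal density
  vanishes; since densities are only determined up to null sets, \<open>p\<close> is an arbitrary version.
  The second argument of \<open>p\<close> is the value conditioned on.\<close>

definition conditional_pdf ::
  "'a measure \<Rightarrow> ('a \<Rightarrow> 'b::euclidean_space) \<Rightarrow> ('a \<Rightarrow> 'c::euclidean_space) \<Rightarrow> ('b \<Rightarrow> 'c \<Rightarrow> real) \<Rightarrow> bool"
  where
  "conditional_pdf M X Z p \<longleftrightarrow>
    (\<exists>pxz pz. has_pdf M (lborel \<Otimes>\<^sub>M lborel) (\<lambda>\<omega>. (X \<omega>, Z \<omega>)) pxz \<and>
      has_pdf M lborel Z pz \<and>
      (\<forall>x z. 0 < pz z \<longrightarrow> p x z = pxz (x, z) / pz z))"

definition outer_product :: "real^'n \<Rightarrow> real^'m \<Rightarrow> real^'m^'n" where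
  "outer_product u v = (\<chi> i j. u $ i * v $ j)"

definition cond_mean :: "(real^'n \<Rightarrow> 'c \<Rightarrow> real) \<Rightarrow> 'c \<Rightarrow> real^'n" where
  "cond_mean p z = (\<integral>x. p x z *\<^sub>R x \<partial>lborel)"

definition cond_variance :: "(real^'n \<Rightarrow> 'c \<Rightarrow> real) \<Rightarrow> 'c \<Rightarrow> real^'n^'n" where
  "cond_variance p z =
    (\<integral>x. p x z *\<^sub>R outer_product (x - cond_mean p z) (x - cond_mean p z) \<partial>lborel)"

text \<open>Tuples such as \<open>(w\<^sub>0, \<dots>, w\<^sub>k)\<close> are extensional functions on a finite set of times; Lebesgue
  measure on them is the finite product measure.\<close>

definition segment :: "nat set \<Rightarrow> (nat \<Rightarrow> 'a \<Rightarrow> 'b) \<Rightarrow> 'a \<Rightarrow> nat \<Rightarrow> 'b" where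
  "segment I X \<omega> = (\<lambda>i\<in>I. X i \<omega>)"

abbreviation lborel_tuples :: "nat set \<Rightarrow> (nat \<Rightarrow> 'b::euclidean_space) measure" where
  "lborel_tuples I \<equiv> Pi\<^sub>M I (\<lambda>_. lborel)"

text \<open>The product of the matrix with columns \<open>Y 1, \<dots>, Y n\<close> and the matrix with rows
  \<open>A 1, \<dots>, A n\<close>.\<close>

definition cols_times :: "nat \<Rightarrow> (nat \<Rightarrow> real^'m) \<Rightarrow> (nat \<Rightarrow> real^'r) \<Rightarrow> real^'r^'m" where
  "cols_times n Y A = (\<chi> a l. \<Sum>j=1..n. Y j $ a * A j $ l)"

primrec state :: "(nat \<Rightarrow> 'x \<Rightarrow> 'w \<Rightarrow> 'x) \<Rightarrow> 'x \<Rightarrow> (nat \<Rightarrow> 'w) \<Rightarrow> nat \<Rightarrow> 'x" where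
  "state \<phi> x0 w 0 = x0"
| "state \<phi> x0 w (Suc i) = \<phi> i (state \<phi> x0 w i) (w i)"

text \<open>\<open>indep_vars\<close> requires all random variables to have the same value type, which the initial state
  and the two noise sequences do not; mutual independence is therefore stated for the generated
  \<open>\<sigma>\<close>-algebras, as in the definition of \<open>indep_vars\<close>. Within each noise sequence, arbitrary
  dependence between different times is allowed.\<close>

definition generated_events :: "'a measure \<Rightarrow> 'b measure \<Rightarrow> ('a \<Rightarrow> 'b) \<Rightarrow> 'a set set" where
  "generated_events M N X = {X -` B \<inter> space M | B. B \<in> sets N}"

locale noisy_system = prob_space M
  for M :: "'a measure" +
  fixes k :: nat
    and \<phi> :: "nat \<Rightarrow> real^'n \<Rightarrow> real^'q \<Rightarrow> real^'n"
    and \<gamma> :: "nat \<Rightarrow> real^'n \<Rightarrow> real^'m"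
    and x :: "nat \<Rightarrow> 'a \<Rightarrow> real^'n"
    and w :: "nat \<Rightarrow> 'a \<Rightarrow> real^'q"
    and y v :: "nat \<Rightarrow> 'a \<Rightarrow> real^'m"
    and px0 :: "real^'n \<Rightarrow> real"
    and pw :: "(nat \<Rightarrow> real^'q) \<Rightarrow> real"
    and pv :: "(nat \<Rightarrow> real^'m) \<Rightarrow> real"
  assumes measurable_transition:
      "\<And>i. i \<le> k \<Longrightarrow> (\<lambda>(a, b). \<phi> i a b) \<in> borel_measurable (borel \<Otimes>\<^sub>M borel)"
    and measurable_measurement: "\<And>i. i \<le> k \<Longrightarrow> \<gamma> (Suc i) \<in> borel_measurable borel"
    and transition: "\<And>i \<omega>. i \<le> k \<Longrightarrow> \<omega> \<in> space M \<Longrightarrow> x (Suc i) \<omega> = \<phi> i (x i \<omega>) (w i \<omega>)"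
    and measurement:
      "\<And>i \<omega>. i \<le> k \<Longrightarrow> \<omega> \<in> space M \<Longrightarrow> y (Suc i) \<omega> = \<gamma> (Suc i) (x (Suc i) \<omega>) + v (Suc i) \<omega>"
    and pdf_initial: "has_pdf M lborel (x 0) px0"
    and pdf_process_noise: "has_pdf M (lborel_tuples {0..k}) (segment {0..k} w) pw"
    and pdf_measurement_noise: "has_pdf M (lborel_tuples {1..Suc k}) (segment {1..Suc k} v) pv"
    and zero_mean_process_noise: "\<And>i. i \<le> k \<Longrightarrow> has_bochner_integral M (w i) 0"
    and zero_mean_measurement_noise: "\<And>i. i \<le> k \<Longrightarrow> has_bochner_integral M (v (Suc i)) 0"
    and mutually_independent:
      "indep_sets
        (\<lambda>i. [generated_events M lborel (x 0),
               generated_events M (lborel_tuples {0..k}) (segment {0..k} w),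
               generated_events M (lborel_tuples {1..Suc k}) (segment {1..Suc k} v)] ! i)
        {..<3}"

end

theory Submission imports Defs begin

text \<open>Put \<open>S = (x\<^sub>0, w\<^sub>0\<^sub>:\<^sub>k)\<close>. Then \<open>x\<^sub>k\<^sub>+\<^sub>1 = f S\<close> and \<open>z = h S + \<beta>\<close> with \<open>\<beta>\<close> independent of
  \<open>S\<close>, so a translation in \<open>\<beta>\<close> gives \<open>(S, z)\<close> the joint density \<open>lik \<zeta> s\<close>. Comparing the
  probabilities of \<open>x\<^sub>k\<^sub>+\<^sub>1 \<in> B \<and> z \<in> C\<close> shows that, for almost every \<open>\<zeta>\<close>, the measure with density
  \<open>a \<mapsto> p(a, \<zeta>)\<close> given by the joint density \<open>p\<close> of \<open>(x\<^sub>k\<^sub>+\<^sub>1, z)\<close> is the image under \<open>f\<close> of the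
  measure with density \<open>lik \<zeta>\<close>. Since this is an equality of measures, both integrability and the
  values of Bochner integrals (\<open>0\<close> for non-integrable functions) transfer without moment assumptions;
  dividing by the common total mass \<open>p\<^sub>z(\<zeta>)\<close> yields the quotients.\<close>

text \<open>The exceptional null set must not depend on \<open>B\<close>; it is a union over a countable
  intersection-stable generator of the Borel sets.\<close>

lemma AE_borel_measure_eqI:
  fixes \<mu> \<nu> :: "'c \<Rightarrow> 'b::second_countable_topology measure"
  assumes sets: "\<And>z. sets (\<mu> z) = sets borel" "\<And>z. sets (\<nu> z) = sets borel"
    and fin: "AE z in L. emeasure (\<mu> z) UNIV < \<infinity>"
    and eq: "\<And>B. B \<in> sets borel \<Longrightarrow> AE z in L. emeasure (\<mu> z) B = emeasure (\<nu> z) B"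
  shows "AE z in L. \<mu> z = \<nu> z"
proof -
  obtain B :: "'b set set" where B: "countable B" "topological_basis B"
    using ex_countable_basis by blast
  \<comment> \<open>Closing the countable basis under finite intersections keeps it countable and
    makes it intersection-stable. The empty family contributes \<open>UNIV\<close>, whose measure is
    finite by \<open>fin\<close>, so the constant sequence \<open>UNIV\<close> serves as the
    exhaustion required at the end.\<close>
  define E where "E = Inter ` {F. finite F \<and> F \<subseteq> B}"
  have "countable E"
    unfolding E_def by (intro countable_image countable_Collect_finite_subset B)
  have B_E: "B \<subseteq> E"
  proof
    fix b assume "b \<in> B"
    then show "b \<in> E" unfolding E_def by (intro image_eqI[of _ _ "{b}"]) auto
  qed
  have UNIV_E: "UNIV \<in> E"
    unfolding E_def by (intro image_eqI[of _ _ "{}"]) auto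
  have E_open: "open X" if "X \<in> E" for X
    using that B(2) unfolding E_def by (auto intro!: open_Inter dest: topological_basis_open)
  have Int: "Int_stable E"
  proof (rule Int_stableI)
    fix a b assume "a \<in> E" "b \<in> E"
    then obtain F G where F: "finite F" "F \<subseteq> B" "a = \<Inter>F" and G: "finite G" "G \<subseteq> B" "b = \<Inter>G"
      unfolding E_def by auto
    then have "a \<inter> b = \<Inter>(F \<union> G)" by auto
    then show "a \<inter> b \<in> E"
      unfolding E_def using F G by (intro image_eqI[of _ _ "F \<union> G"]) auto
  qed
  have gen: "sets borel = sigma_sets UNIV E"
  proof (rule antisym)
    show "sets borel \<subseteq> sigma_sets UNIV E"
      unfolding borel_eq_countable_basis[OF B] using B_E by (simp add: sigma_sets_mono')
    show "sigma_sets UNIV E \<subseteq> sets borel"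
      using E_open sets.sigma_sets_subset[of E borel] by (simp add: subset_iff)
  qed
  have "AE z in L. \<forall>X\<in>E. emeasure (\<mu> z) X = emeasure (\<nu> z) X"
    using \<open>countable E\<close> by (intro AE_ball_countable' eq) (auto intro!: borel_open E_open)
  with fin show ?thesis
  proof eventually_elim
    case (elim z)
    show ?case
      using elim UNIV_E
      by (intro measure_eqI_generator_eq[OF Int, of UNIV _ _ "\<lambda>_. UNIV"]) (auto simp: sets gen)
  qed
qed

section \<open>Independence of random variables with different value types\<close>

lemma Int_stable_generated_events: "Int_stable (generated_events M N f)"
  unfolding generated_events_def
proof (rule Int_stableI, clarify)
  fix A B assume "A \<in> sets N" "B \<in> sets N"
  then show "\<exists>C. f -` A \<inter> space M \<inter> (f -` B \<inter> space M) = f -` C \<inter> space M \<and> C \<in> sets N"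
    by (intro exI[of _ "A \<inter> B"]) auto
qed

text \<open>Independence of the generated events is the product rule on rectangles
  \<open>A \<times> B\<close>, and the values on rectangles determine a product of sigma-finite
  measures.\<close>

lemma (in prob_space) distr_Pair_indep_set:
  assumes X[measurable]: "random_variable MX X" and Y[measurable]: "random_variable MY Y"
    and indep: "indep_set (generated_events M MX X) (generated_events M MY Y)"
  shows "distr M MX X \<Otimes>\<^sub>M distr M MY Y = distr M (MX \<Otimes>\<^sub>M MY) (\<lambda>\<omega>. (X \<omega>, Y \<omega>))"
proof (rule pair_measure_eqI)
  interpret X: prob_space "distr M MX X" by (rule prob_space_distr) fact
  interpret Y: prob_space "distr M MY Y" by (rule prob_space_distr) fact
  show "sigma_finite_measure (distr M MX X)" "sigma_finite_measure (distr M MY Y)" ..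
  show "sets (distr M MX X \<Otimes>\<^sub>M distr M MY Y) = sets (distr M (MX \<Otimes>\<^sub>M MY) (\<lambda>\<omega>. (X \<omega>, Y \<omega>)))"
    by simp
  fix A B assume "A \<in> sets (distr M MX X)" "B \<in> sets (distr M MY Y)"
  then have AB[measurable]: "A \<in> sets MX" "B \<in> sets MY" by auto
  have "prob ((X -` A \<inter> space M) \<inter> (Y -` B \<inter> space M)) =
      prob (X -` A \<inter> space M) * prob (Y -` B \<inter> space M)"
    using AB by (intro indep_setD[OF indep]) (auto simp: generated_events_def)
  moreover have "(\<lambda>\<omega>. (X \<omega>, Y \<omega>)) -` (A \<times> B) \<inter> space M = (X -` A \<inter> space M) \<inter> (Y -` B \<inter> space M)"
    by auto
  ultimately show "emeasure (distr M MX X) A * emeasure (distr M MY Y) B =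
      emeasure (distr M (MX \<Otimes>\<^sub>M MY) (\<lambda>\<omega>. (X \<omega>, Y \<omega>))) (A \<times> B)"
    by (simp add: emeasure_distr emeasure_eq_measure ennreal_mult)
qed

text \<open>Merging disjoint blocks of independent, intersection-stable families preserves
  independence of the generated sigma-algebras. The third variable is thus independent of everything
  generated by the first two, which includes the events of their pair.\<close>

lemma (in prob_space) indep_set_generated_events:
  fixes X :: "'a \<Rightarrow> 'b" and Y :: "'a \<Rightarrow> 'c" and Z :: "'a \<Rightarrow> 'd"
  assumes X: "random_variable MX X" and Y: "random_variable MY Y" and Z: "random_variable MZ Z"
    and indep: "indep_sets
      (\<lambda>i. [generated_events M MX X, generated_events M MY Y, generated_events M MZ Z] ! i) {..<3}"
  shows indep_set_first_second: "indep_set (generated_events M MX X) (generated_events M MY Y)"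
    and indep_set_Pair_third: "indep_set
      (generated_events M (MX \<Otimes>\<^sub>M MY) (\<lambda>\<omega>. (X \<omega>, Y \<omega>))) (generated_events M MZ Z)"
proof -
  define E where
    "E = (\<lambda>i. [generated_events M MX X, generated_events M MY Y, generated_events M MZ Z] ! i)"
  have E: "E 0 = generated_events M MX X" "E (Suc 0) = generated_events M MY Y"
    "E 2 = generated_events M MZ Z"
    by (auto simp: E_def)
  \<comment> \<open>\<open>I True\<close> and \<open>I False\<close> are the two blocks of indices;
    the blocks {0}, {1} give the first claim and {0, 1}, {2} the second.\<close>
  have coarser: "indep_sets (\<lambda>j. sigma_sets (space M) (\<Union>i\<in>I j. E i)) UNIV"
    if "\<And>j. I j \<subseteq> {..<3}" "disjoint_family I" for I :: "bool \<Rightarrow> nat set"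
  proof (rule indep_sets_collect_sigma)
    show "indep_sets E (\<Union>j\<in>UNIV. I j)"
      using indep that(1) unfolding E_def by (intro indep_sets_mono_index[OF _ indep]) auto
    show "Int_stable (E i)" if "j \<in> UNIV" "i \<in> I j" for i j
    proof -
      have "i < 3" using that(2) \<open>\<And>j. I j \<subseteq> {..<3}\<close> by blast
      then have "i = 0 \<or> i = Suc 0 \<or> i = 2" by auto
      then show ?thesis by (auto simp: E Int_stable_generated_events)
    qed
  qed fact
  have "indep_sets (case_bool (E 0) (E (Suc 0))) UNIV"
    by (rule indep_sets_mono_sets[OF coarser[of "case_bool {0} {Suc 0}"]])
       (auto simp: disjoint_family_on_def split: bool.splits)
  then show "indep_set (generated_events M MX X) (generated_events M MY Y)"
    unfolding indep_set_def E .
  \<comment> \<open>On the sigma-algebra generated by the events of \<open>X\<close> and of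
    \<open>Y\<close> both maps are measurable, hence so is the pair.\<close>
  have fine: "generated_events M (MX \<Otimes>\<^sub>M MY) (\<lambda>\<omega>. (X \<omega>, Y \<omega>)) \<subseteq> sigma_sets (space M) (E 0 \<union> E (Suc 0))"
  proof -
    let ?S = "sigma (space M) (E 0 \<union> E (Suc 0))"
    have ES: "E 0 \<union> E (Suc 0) \<subseteq> Pow (space M)"
      unfolding E generated_events_def by auto
    have "X \<in> ?S \<rightarrow>\<^sub>M MX"
    proof (rule measurableI)
      show "X -` A \<inter> space ?S \<in> sets ?S" if "A \<in> sets MX" for A
        using that ES by (auto simp: E generated_events_def)
    qed (use ES measurable_space[OF X] in \<open>simp add: space_measure_of\<close>)
    moreover have "Y \<in> ?S \<rightarrow>\<^sub>M MY"
    proof (rule measurableI)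
      show "Y -` A \<inter> space ?S \<in> sets ?S" if "A \<in> sets MY" for A
        using that ES by (auto simp: E generated_events_def)
    qed (use ES measurable_space[OF Y] in \<open>simp add: space_measure_of\<close>)
    ultimately have "(\<lambda>\<omega>. (X \<omega>, Y \<omega>)) \<in> ?S \<rightarrow>\<^sub>M MX \<Otimes>\<^sub>M MY"
      by measurable
    then show ?thesis
      using ES by (auto simp: generated_events_def space_measure_of dest!: measurable_sets)
  qed
  have "indep_sets
      (case_bool (generated_events M (MX \<Otimes>\<^sub>M MY) (\<lambda>\<omega>. (X \<omega>, Y \<omega>))) (E 2)) UNIV"
    by (rule indep_sets_mono_sets[OF coarser[of "case_bool {0, Suc 0} {2}"]])
       (use fine in \<open>auto simp: disjoint_family_on_def split: bool.splits\<close>)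
  then show "indep_set
      (generated_events M (MX \<Otimes>\<^sub>M MY) (\<lambda>\<omega>. (X \<omega>, Y \<omega>))) (generated_events M MZ Z)"
    unfolding indep_set_def E .
qed

section \<open>Conditional law under independent additive noise\<close>

lemma has_pdf_measurable:
  assumes "has_pdf M N X p"
  shows "p \<in> borel_measurable N"
proof -
  have "(\<lambda>x. ennreal (p x)) \<in> borel_measurable N" and nn: "\<And>x. x \<in> space N \<Longrightarrow> 0 \<le> p x"
    using assms by (auto simp: has_pdf_def distributed_def)
  from this(1) have "(\<lambda>x. enn2real (ennreal (p x))) \<in> borel_measurable N"
    by measurable
  also have "?this \<longleftrightarrow> ?thesis"
    by (rule measurable_cong) (simp add: nn)
  finally show ?thesis .
qed

text \<open>For fixed \<open>B\<close>, the probability of \<open>X \<in> B\<close> and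
  \<open>z \<in> C\<close> is written in two ways as an integral over \<open>C\<close>: through the
  joint density \<open>g\<close>, and through the product density of \<open>S\<close> and
  \<open>\<beta>\<close> after the shift \<open>b = \<zeta> - h s\<close>. Uniqueness of densities
  in \<open>\<zeta>\<close> gives equality at \<open>B\<close> almost everywhere, and
  \<open>AE_borel_measure_eqI\<close> makes the null set uniform in \<open>B\<close>. The map
  \<open>f\<close> may be far from injective, hence an image measure and not a change of
  density.\<close>

lemma (in prob_space) AE_conditional_law_additive_noise:
  fixes \<beta> :: "'a \<Rightarrow> 'c::euclidean_space" and f :: "'s \<Rightarrow> 'b::euclidean_space"
  assumes N: "sigma_finite_measure N"
    and S: "distributed M N S (\<lambda>s. ennreal (pS s))" and pS_nn: "\<And>s. s \<in> space N \<Longrightarrow> 0 \<le> pS s"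
    and pS[measurable]: "pS \<in> borel_measurable N"
    and \<beta>: "has_pdf M lborel \<beta> p\<beta>"
    and indep: "indep_set (generated_events M N S) (generated_events M lborel \<beta>)"
    and h[measurable]: "h \<in> borel_measurable N" and f[measurable]: "f \<in> borel_measurable N"
    and z: "\<And>\<omega>. \<omega> \<in> space M \<Longrightarrow> z \<omega> = h (S \<omega>) + \<beta> \<omega>"
    and X: "\<And>\<omega>. \<omega> \<in> space M \<Longrightarrow> X \<omega> = f (S \<omega>)"
    and g: "has_pdf M (lborel \<Otimes>\<^sub>M lborel) (\<lambda>\<omega>. (X \<omega>, z \<omega>)) g"
  shows "AE \<zeta> in lborel. density lborel (\<lambda>a. ennreal (g (a, \<zeta>))) =
    distr (density N (\<lambda>s. ennreal (pS s * p\<beta> (\<zeta> - h s)))) lborel f"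
proof (rule AE_borel_measure_eqI)
  interpret N: sigma_finite_measure N by fact
  interpret NL: pair_sigma_finite N "lborel :: 'c measure" ..
  note [measurable] = has_pdf_measurable[OF \<beta>, simplified] has_pdf_measurable[OF g]
  have p\<beta>_nn: "0 \<le> p\<beta> b" for b using \<beta> by (simp add: has_pdf_def)
  have [measurable]: "S \<in> M \<rightarrow>\<^sub>M N" using S by (simp add: distributed_def)
  have [measurable]: "\<beta> \<in> borel_measurable M" using \<beta> by (simp add: has_pdf_def distributed_def)
  have joint: "distributed M (N \<Otimes>\<^sub>M lborel) (\<lambda>\<omega>. (S \<omega>, \<beta> \<omega>)) (\<lambda>(s, b). ennreal (pS s) * ennreal (p\<beta> b))"
    using \<beta> by (intro distributed_joint_indep' distr_Pair_indep_set N sigma_finite_lborel S indep)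
      (simp_all add: has_pdf_def)
  note gd = g[unfolded has_pdf_def, THEN conjunct2]
  show "sets (density lborel (\<lambda>a. ennreal (g (a, \<zeta>)))) = sets borel" for \<zeta> by simp
  show "sets (distr (density N (\<lambda>s. ennreal (pS s * p\<beta> (\<zeta> - h s)))) lborel f) = sets borel" for \<zeta>
    by simp
  have left: "emeasure (density lborel (\<lambda>a. ennreal (g (a, \<zeta>)))) B =
      (\<integral>\<^sup>+a. ennreal (g (a, \<zeta>)) * indicator B a \<partial>lborel)" if "B \<in> sets borel" for B \<zeta>
    using that by (intro emeasure_density) auto
  have right: "emeasure (distr (density N (\<lambda>s. ennreal (pS s * p\<beta> (\<zeta> - h s)))) lborel f) B =
      (\<integral>\<^sup>+s. ennreal (pS s * p\<beta> (\<zeta> - h s)) * indicator B (f s) \<partial>N)" if [measurable]: "B \<in> sets borel" for B \<zeta>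
    by (subst emeasure_distr, simp, simp, subst emeasure_density)
       (auto intro!: nn_integral_cong split: split_indicator)
  have prob_left: "emeasure M {\<omega>\<in>space M. X \<omega> \<in> B \<and> z \<omega> \<in> C} =
      (\<integral>\<^sup>+\<zeta>. (\<integral>\<^sup>+a. ennreal (g (a, \<zeta>)) * indicator B a \<partial>lborel) * indicator C \<zeta> \<partial>lborel)"
    if [measurable]: "B \<in> sets borel" "C \<in> sets borel" for B C
  proof -
    have "emeasure M {\<omega>\<in>space M. X \<omega> \<in> B \<and> z \<omega> \<in> C} =
        emeasure M ((\<lambda>\<omega>. (X \<omega>, z \<omega>)) -` (B \<times> C) \<inter> space M)"
      by (intro arg_cong[where f = "emeasure M"]) auto
    also have "\<dots> = (\<integral>\<^sup>+p. ennreal (g p) * indicator (B \<times> C) p \<partial>(lborel \<Otimes>\<^sub>M lborel))"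
      by (rule distributed_emeasure[OF gd]) simp
    also have "\<dots> = (\<integral>\<^sup>+\<zeta>. (\<integral>\<^sup>+a. ennreal (g (a, \<zeta>)) * indicator (B \<times> C) (a, \<zeta>) \<partial>lborel) \<partial>lborel)"
      by (rule lborel_pair.nn_integral_snd[symmetric]) simp
    also have "\<dots> = (\<integral>\<^sup>+\<zeta>. (\<integral>\<^sup>+a. ennreal (g (a, \<zeta>)) * indicator B a \<partial>lborel) * indicator C \<zeta> \<partial>lborel)"
      by (intro nn_integral_cong) (auto intro!: nn_integral_cong split: split_indicator)
    finally show ?thesis .
  qed
  have prob_right: "emeasure M {\<omega>\<in>space M. X \<omega> \<in> B \<and> z \<omega> \<in> C} =
      (\<integral>\<^sup>+\<zeta>. (\<integral>\<^sup>+s. ennreal (pS s * p\<beta> (\<zeta> - h s)) * indicator B (f s) \<partial>N) * indicator C \<zeta> \<partial>lborel)"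
    if [measurable]: "B \<in> sets borel" "C \<in> sets borel" for B C
  proof -
    \<comment> \<open>The event is pulled back to pairs (s, b), since \<open>X\<close> and
      \<open>z\<close> are both functions of \<open>S\<close> and \<open>\<beta>\<close>.\<close>
    define D where "D = {p \<in> space (N \<Otimes>\<^sub>M lborel). f (fst p) \<in> B \<and> h (fst p) + snd p \<in> C}"
    have D[measurable]: "D \<in> sets (N \<Otimes>\<^sub>M lborel)" unfolding D_def by measurable
    have "emeasure M {\<omega>\<in>space M. X \<omega> \<in> B \<and> z \<omega> \<in> C} =
        emeasure M ((\<lambda>\<omega>. (S \<omega>, \<beta> \<omega>)) -` D \<inter> space M)"
      using measurable_space[OF \<open>S \<in> M \<rightarrow>\<^sub>M N\<close>]
      by (intro arg_cong[where f = "emeasure M"]) (auto simp: D_def X z space_pair_measure)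
    also have "\<dots> = (\<integral>\<^sup>+p. (\<lambda>(s, b). ennreal (pS s) * ennreal (p\<beta> b)) p * indicator D p \<partial>(N \<Otimes>\<^sub>M lborel))"
      by (rule distributed_emeasure[OF joint D])
    also have "\<dots> = (\<integral>\<^sup>+s. (\<integral>\<^sup>+b. ennreal (pS s) * ennreal (p\<beta> b) * indicator D (s, b) \<partial>lborel) \<partial>N)"
      by (subst lborel.nn_integral_fst[symmetric]) auto
    also have "\<dots> = (\<integral>\<^sup>+s. (\<integral>\<^sup>+\<zeta>. ennreal (pS s) * ennreal (p\<beta> (\<zeta> - h s)) * indicator D (s, \<zeta> - h s) \<partial>lborel) \<partial>N)"
    proof (rule nn_integral_cong)
      fix s assume [measurable]: "s \<in> space N"
      \<comment> \<open>Lebesgue measure is its own image under translation by \<open>- h s\<close>;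
        this turns the noise variable \<open>b\<close> into the measurement variable
        \<open>\<zeta>\<close>.\<close>
      have "(\<integral>\<^sup>+b. ennreal (pS s) * ennreal (p\<beta> b) * indicator D (s, b) \<partial>lborel) =
        (\<integral>\<^sup>+b. ennreal (pS s) * ennreal (p\<beta> b) * indicator D (s, b) \<partial>distr lborel borel ((+) (- h s)))"
        by (simp add: lborel_distr_plus)
      also have "\<dots> = (\<integral>\<^sup>+\<zeta>. ennreal (pS s) * ennreal (p\<beta> (\<zeta> - h s)) * indicator D (s, \<zeta> - h s) \<partial>lborel)"
        by (subst nn_integral_distr) (auto simp: algebra_simps)
      finally show "(\<integral>\<^sup>+b. ennreal (pS s) * ennreal (p\<beta> b) * indicator D (s, b) \<partial>lborel) =
        (\<integral>\<^sup>+\<zeta>. ennreal (pS s) * ennreal (p\<beta> (\<zeta> - h s)) * indicator D (s, \<zeta> - h s) \<partial>lborel)" .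
    qed
    \<comment> \<open>Because \<open>h s + (\<zeta> - h s) = \<zeta>\<close>, the indicator of
      \<open>D\<close> splits into a factor in \<open>f s\<close> and a factor in
      \<open>\<zeta>\<close>. Tonelli then makes \<open>\<zeta>\<close> the outer variable, as in
      \<open>prob_left\<close>.\<close>
    also have "\<dots> = (\<integral>\<^sup>+s. (\<integral>\<^sup>+\<zeta>. ennreal (pS s * p\<beta> (\<zeta> - h s)) * indicator B (f s) * indicator C \<zeta> \<partial>lborel) \<partial>N)"
      by (intro nn_integral_cong)
         (auto simp: D_def space_pair_measure ennreal_mult pS_nn p\<beta>_nn split: split_indicator)
    also have "\<dots> = (\<integral>\<^sup>+\<zeta>. (\<integral>\<^sup>+s. ennreal (pS s * p\<beta> (\<zeta> - h s)) * indicator B (f s) * indicator C \<zeta> \<partial>N) \<partial>lborel)"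
      by (rule NL.Fubini'[symmetric]) measurable
    also have "\<dots> = (\<integral>\<^sup>+\<zeta>. (\<integral>\<^sup>+s. ennreal (pS s * p\<beta> (\<zeta> - h s)) * indicator B (f s) \<partial>N) * indicator C \<zeta> \<partial>lborel)"
      by (intro nn_integral_cong nn_integral_multc) measurable
    finally show ?thesis .
  qed
  show "AE \<zeta> in lborel. emeasure (density lborel (\<lambda>a. ennreal (g (a, \<zeta>)))) B =
      emeasure (distr (density N (\<lambda>s. ennreal (pS s * p\<beta> (\<zeta> - h s)))) lborel f) B"
    if B[measurable]: "B \<in> sets borel" for B
    unfolding left[OF B] right[OF B]
    by (rule sigma_finite_measure.density_unique2[OF sigma_finite_lborel]) (auto simp flip: prob_left[OF B] prob_right[OF B])
  \<comment> \<open>With \<open>B = C = UNIV\<close> the double integral is the total probability 1,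
    so almost every slice of \<open>g\<close> has finite mass.\<close>
  have "(\<integral>\<^sup>+\<zeta>. (\<integral>\<^sup>+a. ennreal (g (a, \<zeta>)) \<partial>lborel) \<partial>lborel) \<noteq> \<infinity>"
    using prob_left[of UNIV UNIV] by (simp add: emeasure_space_1)
  then have "AE \<zeta> in lborel. (\<integral>\<^sup>+a. ennreal (g (a, \<zeta>)) \<partial>lborel) \<noteq> \<infinity>"
    by (intro nn_integral_PInf_AE) auto
  then show "AE \<zeta> in lborel. emeasure (density lborel (\<lambda>a. ennreal (g (a, \<zeta>)))) UNIV < \<infinity>"
    by eventually_elim (simp add: left less_top)
qed

text \<open>Both sides are integrals of \<open>F\<close> against the single measure in
  \<open>eq\<close>, read once as a density over \<open>L\<close> and once as an image under
  \<open>f\<close>. Banach-valued \<open>F\<close> covers the normalising mass, the mean vector and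
  the variance matrix alike.\<close>

lemma integral_density_eq_distr:
  fixes F :: "'b \<Rightarrow> 'e::{banach, second_countable_topology}" and g :: "'b \<Rightarrow> real" and l :: "'s \<Rightarrow> real"
  assumes [measurable]: "g \<in> borel_measurable L" "l \<in> borel_measurable N" "f \<in> N \<rightarrow>\<^sub>M L"
      "F \<in> borel_measurable L"
    and nn: "\<And>a. a \<in> space L \<Longrightarrow> 0 \<le> g a" "\<And>s. s \<in> space N \<Longrightarrow> 0 \<le> l s"
    and eq: "density L (\<lambda>a. ennreal (g a)) = distr (density N (\<lambda>s. ennreal (l s))) L f"
  shows "integrable L (\<lambda>a. g a *\<^sub>R F a) \<longleftrightarrow> integrable N (\<lambda>s. l s *\<^sub>R F (f s))"
    and "(\<integral>a. g a *\<^sub>R F a \<partial>L) = (\<integral>s. l s *\<^sub>R F (f s) \<partial>N)"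
proof -
  have "integrable L (\<lambda>a. g a *\<^sub>R F a) \<longleftrightarrow> integrable (density L (\<lambda>a. ennreal (g a))) F"
    by (intro integrable_density[symmetric]) (auto intro!: AE_I2 nn)
  also have "\<dots> \<longleftrightarrow> integrable (density N (\<lambda>s. ennreal (l s))) (\<lambda>s. F (f s))"
    unfolding eq by (intro integrable_distr_eq) auto
  also have "\<dots> \<longleftrightarrow> integrable N (\<lambda>s. l s *\<^sub>R F (f s))"
    by (intro integrable_density) (auto intro!: AE_I2 nn)
  finally show "integrable L (\<lambda>a. g a *\<^sub>R F a) \<longleftrightarrow> integrable N (\<lambda>s. l s *\<^sub>R F (f s))" .
  have "(\<integral>a. g a *\<^sub>R F a \<partial>L) = (\<integral>a. F a \<partial>density L (\<lambda>a. ennreal (g a)))"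
    by (intro integral_density[symmetric]) (auto intro!: AE_I2 nn)
  also have "\<dots> = (\<integral>s. F (f s) \<partial>density N (\<lambda>s. ennreal (l s)))"
    unfolding eq by (intro integral_distr) auto
  also have "\<dots> = (\<integral>s. l s *\<^sub>R F (f s) \<partial>N)"
    by (intro integral_density) (auto intro!: AE_I2 nn)
  finally show "(\<integral>a. g a *\<^sub>R F a \<partial>L) = (\<integral>s. l s *\<^sub>R F (f s) \<partial>N)" .
qed

section \<open>Matrix products and their measurability\<close>

text \<open>The column-row expansion of a matrix product; it reduces measurability to that of outer
  products.\<close>

lemma cols_times_sum: "cols_times n Y A = (\<Sum>j=1..n. outer_product (Y j) (A j))"
  by (simp add: cols_times_def outer_product_def vec_eq_iff)

lemma cols_times_cong:
  "(\<And>j. 1 \<le> j \<Longrightarrow> j \<le> n \<Longrightarrow> Y j = Y' j) \<Longrightarrow> cols_times n Y A = cols_times n Y' A"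
  unfolding cols_times_sum by (intro sum.cong) auto

lemma cols_times_add: "cols_times n (\<lambda>j. X j + Y j) A = cols_times n X A + cols_times n Y A"
  by (simp add: cols_times_def vec_eq_iff distrib_right sum.distrib)

lemma outer_product_measurable:
  assumes "f \<in> borel_measurable M" "g \<in> borel_measurable M"
  shows "(\<lambda>x. outer_product (f x) (g x)) \<in> borel_measurable M"
proof -
  have "continuous_on UNIV (\<lambda>p. outer_product (fst p) (snd p :: real^'m) :: real^'m^'n)"
    unfolding outer_product_def by (intro continuous_intros)
  then show ?thesis
    by (rule borel_measurable_continuous_Pair[OF assms])
qed

lemma cols_times_measurable:
  assumes "\<And>j. 1 \<le> j \<Longrightarrow> j \<le> n \<Longrightarrow> f j \<in> borel_measurable M"
  shows "(\<lambda>s. cols_times n (\<lambda>j. f j s) A) \<in> borel_measurable M"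
  unfolding cols_times_sum
  by (intro borel_measurable_sum outer_product_measurable assms) auto

section \<open>States as functions of the initial state and the process noise\<close>

context noisy_system
begin

text \<open>The state at time \<open>i\<close> involves only the noise at times below
  \<open>i\<close>. For \<open>i \<le> Suc k\<close> these times lie in \<open>{0..k}\<close>, where
  \<open>segment\<close> agrees with \<open>w\<close>.\<close>

lemma state_eq:
  assumes "i \<le> Suc k" "\<omega> \<in> space M"
  shows "x i \<omega> = state \<phi> (x 0 \<omega>) (segment {0..k} w \<omega>) i"
  using assms by (induction i) (auto simp: transition segment_def)

lemma state_measurable:
  assumes "i \<le> Suc k"
  shows "(\<lambda>s. state \<phi> (fst s) (snd s) i) \<in> borel_measurable (lborel \<Otimes>\<^sub>M lborel_tuples {0..k})"
  using assms
proof (induction i)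
  case 0
  show ?case by simp
next
  case (Suc i)
  let ?N = "(lborel :: (real^'n) measure) \<Otimes>\<^sub>M (lborel_tuples {0..k} :: (nat \<Rightarrow> real^'q) measure)"
  have "(\<lambda>s. snd s i) \<in> ?N \<rightarrow>\<^sub>M lborel"
    using Suc.prems by (intro measurable_compose[OF measurable_snd measurable_component_singleton]) auto
  with Suc have "(\<lambda>s. (state \<phi> (fst s) (snd s) i, snd s i)) \<in> ?N \<rightarrow>\<^sub>M borel \<Otimes>\<^sub>M borel"
    by (intro measurable_Pair) auto
  from measurable_compose[OF this measurable_transition[of i]] Suc.prems show ?case
    by simp
qed

lemma initial_noise_measurable:
  "x 0 \<in> M \<rightarrow>\<^sub>M lborel"
  "segment {0..k} w \<in> M \<rightarrow>\<^sub>M lborel_tuples {0..k}"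
  "segment {1..Suc k} v \<in> M \<rightarrow>\<^sub>M lborel_tuples {1..Suc k}"
  using pdf_initial pdf_process_noise pdf_measurement_noise by (simp_all add: has_pdf_def distributed_def)

end

lemma sigma_finite_lborel_tuples:
  "finite I \<Longrightarrow> sigma_finite_measure (lborel_tuples I :: (nat \<Rightarrow> 'b::euclidean_space) measure)"
proof -
  assume "finite I"
  interpret product_sigma_finite "\<lambda>_::nat. lborel :: 'b measure"
    by (simp add: product_sigma_finite_def sigma_finite_lborel)
  show ?thesis by (rule sigma_finite) fact
qed

text \<open>The claim holds for almost every value under the law of \<open>z\<close>, because a
  conditional density is determined only up to null sets and where the marginal density is positive.
  Finiteness and positivity of the denominator make the quotients meaningful; the equivalences say
  that each moment integral exists on one side exactly when it exists on the other.\<close>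

theorem corollary5:
  fixes M :: "'a measure"
    and k :: nat
    and \<phi> :: "nat \<Rightarrow> real^'n \<Rightarrow> real^'q \<Rightarrow> real^'n"
    and \<gamma> :: "nat \<Rightarrow> real^'n \<Rightarrow> real^'m"
    and x :: "nat \<Rightarrow> 'a \<Rightarrow> real^'n"
    and w :: "nat \<Rightarrow> 'a \<Rightarrow> real^'q"
    and y v :: "nat \<Rightarrow> 'a \<Rightarrow> real^'m"
    and px0 :: "real^'n \<Rightarrow> real"
    and pw :: "(nat \<Rightarrow> real^'q) \<Rightarrow> real"
    and pv :: "(nat \<Rightarrow> real^'m) \<Rightarrow> real"
    and A :: "nat \<Rightarrow> real^'r"
    and z \<beta> :: "'a \<Rightarrow> real^'r^'m"
    and p\<beta> :: "real^'r^'m \<Rightarrow> real"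
    and pxz :: "real^'n \<Rightarrow> real^'r^'m \<Rightarrow> real"
  defines "N \<equiv> lborel \<Otimes>\<^sub>M lborel_tuples {0..k}"
    and "lik \<equiv> \<lambda>\<zeta> (x0, u). px0 x0 * pw u *
      p\<beta> (\<zeta> - cols_times (Suc k) (\<lambda>j. \<gamma> j (state \<phi> x0 u j)) A)"
    and "next_state \<equiv> \<lambda>(x0, u). \<phi> k (state \<phi> x0 u k) (u k)"
  assumes system: "noisy_system M k \<phi> \<gamma> x w y v px0 pw pv"
    and z: "\<And>\<omega>. \<omega> \<in> space M \<Longrightarrow> z \<omega> = cols_times (Suc k) (\<lambda>j. y j \<omega>) A"
    and \<beta>: "\<And>\<omega>. \<omega> \<in> space M \<Longrightarrow> \<beta> \<omega> = cols_times (Suc k) (\<lambda>j. v j \<omega>) A"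
    and pdf_\<beta>: "has_pdf M lborel \<beta> p\<beta>"
    and cond: "conditional_pdf M (x (Suc k)) z pxz"
  shows "AE \<zeta> in distr M lborel z.
    integrable N (lik \<zeta>) \<and> 0 < (\<integral>s. lik \<zeta> s \<partial>N) \<and>
    (integrable lborel (\<lambda>a. pxz a \<zeta> *\<^sub>R a) \<longleftrightarrow>
      integrable N (\<lambda>s. lik \<zeta> s *\<^sub>R next_state s)) \<and>
    cond_mean pxz \<zeta> = (\<integral>s. lik \<zeta> s *\<^sub>R next_state s \<partial>N) /\<^sub>R (\<integral>s. lik \<zeta> s \<partial>N) \<and>
    (integrable lborel
        (\<lambda>a. pxz a \<zeta> *\<^sub>R outer_product (a - cond_mean pxz \<zeta>) (a - cond_mean pxz \<zeta>)) \<longleftrightarrow>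
      integrable N (\<lambda>s. lik \<zeta> s *\<^sub>R
        outer_product (next_state s - cond_mean pxz \<zeta>) (next_state s - cond_mean pxz \<zeta>))) \<and>
    cond_variance pxz \<zeta> =
      (\<integral>s. lik \<zeta> s *\<^sub>R
        outer_product (next_state s - cond_mean pxz \<zeta>) (next_state s - cond_mean pxz \<zeta>) \<partial>N)
      /\<^sub>R (\<integral>s. lik \<zeta> s \<partial>N)"
  (is "AE \<zeta> in _. ?P \<zeta>")
proof -
  interpret noisy_system M k \<phi> \<gamma> x w y v px0 pw pv by (rule system)
  \<comment> \<open>In the notation of the additive-noise lemma, \<open>S\<close> is the hidden
    source, \<open>pS\<close> its density, and \<open>h\<close> the noise-free part of
    \<open>z\<close>.\<close>
  define S where "S = (\<lambda>\<omega>. (x 0 \<omega>, segment {0..k} w \<omega>))"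
  define pS where "pS = (\<lambda>s. px0 (fst s) * pw (snd s))"
  define h where "h = (\<lambda>s. cols_times (Suc k) (\<lambda>j. \<gamma> j (state \<phi> (fst s) (snd s) j)) A)"
  note independent = indep_set_first_second[OF initial_noise_measurable mutually_independent]
    indep_set_Pair_third[OF initial_noise_measurable mutually_independent]
  have W: "sigma_finite_measure (lborel_tuples {0..k} :: (nat \<Rightarrow> real^'q) measure)"
    by (rule sigma_finite_lborel_tuples) simp
  interpret W: sigma_finite_measure "lborel_tuples {0..k} :: (nat \<Rightarrow> real^'q) measure" by (rule W)
  interpret LW: pair_sigma_finite "lborel :: (real^'n) measure"
    "lborel_tuples {0..k} :: (nat \<Rightarrow> real^'q) measure" ..
  have N: "sigma_finite_measure N"
    unfolding N_def by (rule LW.sigma_finite_measure_axioms)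
  have lik: "lik \<zeta> = (\<lambda>s. pS s * p\<beta> (\<zeta> - h s))" for \<zeta>
    by (auto simp: lik_def pS_def h_def fun_eq_iff)
  have next_state: "next_state = (\<lambda>s. state \<phi> (fst s) (snd s) (Suc k))"
    by (auto simp: next_state_def fun_eq_iff)
  have next_state_meas[measurable]: "next_state \<in> borel_measurable N"
    unfolding next_state N_def by (rule state_measurable) simp
  have h_meas[measurable]: "h \<in> borel_measurable N"
    unfolding h_def
  proof (rule cols_times_measurable)
    fix j assume "1 \<le> j" "j \<le> Suc k"
    then obtain i where "j = Suc i" "i \<le> k" by (cases j) auto
    then show "(\<lambda>s. \<gamma> j (state \<phi> (fst s) (snd s) j)) \<in> borel_measurable N"
      using measurable_compose[OF state_measurable[of j] measurable_measurement[of i]]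
      by (simp add: N_def)
  qed
  have [measurable]: "px0 \<in> borel_measurable lborel" "pw \<in> borel_measurable (lborel_tuples {0..k})"
    using has_pdf_measurable pdf_initial pdf_process_noise by blast+
  have pS_meas[measurable]: "pS \<in> borel_measurable N"
    unfolding pS_def N_def by measurable
  have pS_nn: "0 \<le> pS s" if "s \<in> space N" for s
    using that pdf_initial pdf_process_noise
    by (auto simp: N_def pS_def has_pdf_def space_pair_measure)
  have p\<beta>_nn: "0 \<le> p\<beta> b" for b using pdf_\<beta> by (simp add: has_pdf_def)
  have p\<beta>_meas[measurable]: "p\<beta> \<in> borel_measurable borel"
    using has_pdf_measurable[OF pdf_\<beta>] by simp
  have "distributed M N S (\<lambda>(a, u). ennreal (px0 a) * ennreal (pw u))"
    unfolding N_def S_def using pdf_initial pdf_process_noise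
    by (intro distributed_joint_indep' sigma_finite_lborel W distr_Pair_indep_set
          initial_noise_measurable independent) (simp_all add: has_pdf_def)
  \<comment> \<open>\<open>ennreal\<close> is multiplicative only on nonnegative reals, and the
    densities are known to be nonnegative only on their spaces; hence the congruence restricted to
    the space of \<open>N\<close>.\<close>
  also have "?this \<longleftrightarrow> distributed M N S (\<lambda>s. ennreal (pS s))"
    unfolding distributed_def using pdf_initial pdf_process_noise
    by (intro conj_cong arg_cong2[where f = "(=)"] refl density_cong measurable_cong)
      (auto simp: N_def pS_def has_pdf_def space_pair_measure ennreal_mult)
  finally have S: "distributed M N S (\<lambda>s. ennreal (pS s))" .
  \<comment> \<open>\<open>\<beta>\<close> is a measurable function \<open>T\<close> of the
    measurement noise tuple, so it inherits independence from \<open>S\<close>.\<close>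
  have "generated_events M lborel \<beta> \<subseteq>
      generated_events M (lborel_tuples {1..Suc k}) (segment {1..Suc k} v)"
  proof
    fix E assume "E \<in> generated_events M lborel \<beta>"
    then obtain B where B: "B \<in> sets borel" "E = \<beta> -` B \<inter> space M"
      by (auto simp: generated_events_def)
    define T where "T = (\<lambda>u. cols_times (Suc k) u A :: real^'r^'m)"
    have "T \<in> lborel_tuples {1..Suc k} \<rightarrow>\<^sub>M borel"
      unfolding T_def
      by (rule cols_times_measurable, rule measurable_compose[OF measurable_component_singleton]) auto
    then have "T -` B \<inter> space (lborel_tuples {1..Suc k}) \<in> sets (lborel_tuples {1..Suc k})"
      using B(1) by (rule measurable_sets)
    moreover have "\<beta> \<omega> = T (segment {1..Suc k} v \<omega>)" if "\<omega> \<in> space M" for \<omega>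
      unfolding \<beta>[OF that] T_def by (rule cols_times_cong) (simp add: segment_def)
    then have "E = segment {1..Suc k} v -` (T -` B \<inter> space (lborel_tuples {1..Suc k})) \<inter> space M"
      unfolding B(2) using measurable_space[OF initial_noise_measurable(3)] by auto
    ultimately show "E \<in> generated_events M (lborel_tuples {1..Suc k}) (segment {1..Suc k} v)"
      unfolding generated_events_def by blast
  qed
  then have S_\<beta>: "indep_set (generated_events M N S) (generated_events M lborel \<beta>)"
    unfolding indep_set_def N_def S_def
    by (intro indep_sets_mono_sets[OF independent(2)[unfolded indep_set_def]])
      (auto split: bool.splits)
  have z_eq: "z \<omega> = h (S \<omega>) + \<beta> \<omega>" if "\<omega> \<in> space M" for \<omega>
  proof -
    have "z \<omega> = cols_times (Suc k) (\<lambda>j. \<gamma> j (state \<phi> (x 0 \<omega>) (segment {0..k} w \<omega>) j) + v j \<omega>) A"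
      unfolding z[OF that]
    proof (rule cols_times_cong)
      fix j assume "1 \<le> j" "j \<le> Suc k"
      then obtain i where "j = Suc i" "i \<le> k" by (cases j) auto
      then show "y j \<omega> = \<gamma> j (state \<phi> (x 0 \<omega>) (segment {0..k} w \<omega>) j) + v j \<omega>"
        using measurement[of i \<omega>] state_eq[of j \<omega>] that by simp
    qed
    then show ?thesis
      by (simp add: cols_times_add h_def S_def \<beta>[OF that])
  qed
  obtain g pz where g: "has_pdf M (lborel \<Otimes>\<^sub>M lborel) (\<lambda>\<omega>. (x (Suc k) \<omega>, z \<omega>)) g"
    and pz: "has_pdf M lborel z pz"
    and pxz: "\<And>a \<zeta>. 0 < pz \<zeta> \<Longrightarrow> pxz a \<zeta> = g (a, \<zeta>) / pz \<zeta>"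
    using cond unfolding conditional_pdf_def by blast
  have g_nn: "0 \<le> g p" for p
    using g by (cases p) (simp add: has_pdf_def space_pair_measure)
  have pz_nn: "0 \<le> pz \<zeta>" for \<zeta> using pz by (simp add: has_pdf_def)
  have [measurable]: "g \<in> borel_measurable (lborel \<Otimes>\<^sub>M lborel)" "pz \<in> borel_measurable lborel"
    using has_pdf_measurable[OF g] has_pdf_measurable[OF pz] by auto
  have law: "AE \<zeta> in lborel. density lborel (\<lambda>a. ennreal (g (a, \<zeta>))) =
      distr (density N (\<lambda>s. ennreal (lik \<zeta> s))) lborel next_state"
    unfolding lik
  proof (rule AE_conditional_law_additive_noise
      [OF N S pS_nn pS_meas pdf_\<beta> S_\<beta> h_meas next_state_meas z_eq _ g])
    show "x (Suc k) \<omega> = next_state (S \<omega>)" if "\<omega> \<in> space M" for \<omega>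
      using state_eq[of "Suc k" \<omega>] that by (simp add: next_state S_def)
  qed
  have marginal: "AE \<zeta> in lborel. ennreal (pz \<zeta>) = (\<integral>\<^sup>+a. ennreal (g (a, \<zeta>)) \<partial>lborel)"
    using g pz unfolding has_pdf_def
    by (intro distributed_marginal_eq_joint2[where X = "x (Suc k)"] sigma_finite_lborel) auto
  \<comment> \<open>Since \<open>z\<close> has density \<open>pz\<close>, almost everywhere under
    its law means Lebesgue-almost everywhere on \<open>pz \<zeta> > 0\<close>, which is precisely
    where \<open>pxz\<close> is fixed as a quotient.\<close>
  have "distr M lborel z = density lborel (\<lambda>\<zeta>. ennreal (pz \<zeta>))"
    using pz by (simp add: has_pdf_def distributed_def)
  then show ?thesis
  proof (rule ssubst, subst AE_density)
    show "(\<lambda>\<zeta>. ennreal (pz \<zeta>)) \<in> borel_measurable lborel" by measurable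
    show "AE \<zeta> in lborel. 0 < ennreal (pz \<zeta>) \<longrightarrow> ?P \<zeta>"
      using law marginal
    proof eventually_elim
      case (elim \<zeta>)
      show ?case
      proof
        assume "0 < ennreal (pz \<zeta>)"
        then have pos: "0 < pz \<zeta>" by simp
        have g\<zeta>[measurable]: "(\<lambda>a. g (a, \<zeta>)) \<in> borel_measurable lborel" by measurable
        have lik_meas: "lik \<zeta> \<in> borel_measurable N" unfolding lik by measurable
        have lik_nn: "0 \<le> lik \<zeta> s" if "s \<in> space N" for s
          using that by (simp add: lik pS_nn p\<beta>_nn)
        note transfer = integral_density_eq_distr[OF g\<zeta> lik_meas _ _ g_nn lik_nn elim(1), simplified]
        \<comment> \<open>For fixed \<open>\<zeta>\<close> the conditional density is the joint one
          times a positive constant, which affects integrals by that factor and integrability not at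
          all.\<close>
        have scale: "pxz a \<zeta> *\<^sub>R u = (g (a, \<zeta>) *\<^sub>R u) /\<^sub>R pz \<zeta>" for a and u :: "'e::real_vector"
          by (simp add: pxz[OF pos] divide_inverse mult.commute)
        have rescale: "integrable lborel (\<lambda>a. u a /\<^sub>R pz \<zeta>) \<longleftrightarrow> integrable lborel u"
          for u :: "real^'n \<Rightarrow> 'e::{banach, second_countable_topology}"
          using integrable_scaleR_right[of "inverse (pz \<zeta>)" lborel u]
            integrable_scaleR_right[of "pz \<zeta>" lborel "\<lambda>a. u a /\<^sub>R pz \<zeta>"] pos
          by auto
        have integrable_iff: "integrable lborel (\<lambda>a. pxz a \<zeta> *\<^sub>R F a) \<longleftrightarrow>
            integrable N (\<lambda>s. lik \<zeta> s *\<^sub>R F (next_state s))"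
          and integral_eq: "(\<integral>a. pxz a \<zeta> *\<^sub>R F a \<partial>lborel) =
            (\<integral>s. lik \<zeta> s *\<^sub>R F (next_state s) \<partial>N) /\<^sub>R pz \<zeta>"
          if "F \<in> borel_measurable borel" for F :: "real^'n \<Rightarrow> 'e::{banach, second_countable_topology}"
          unfolding scale rescale transfer[OF that, symmetric] by (simp_all del: scaleR_scaleR)
        \<comment> \<open>The slice of \<open>g\<close> has mass \<open>pz \<zeta>\<close>;
          transferring the constant function 1 identifies this mass with the integral of
          \<open>lik \<zeta>\<close>, the common denominator.\<close>
        have "has_bochner_integral lborel (\<lambda>a. g (a, \<zeta>)) (pz \<zeta>)"
          using elim(2) g_nn pz_nn by (intro has_bochner_integral_nn_integral) auto
        then have lik_int: "integrable N (lik \<zeta>)" and evidence: "(\<integral>s. lik \<zeta> s \<partial>N) = pz \<zeta>"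
          using transfer[of "\<lambda>_. 1 :: real"] by (simp_all add: has_bochner_integral_iff)
        \<comment> \<open>With \<open>\<zeta>\<close> fixed the conditional mean is a constant
          vector \<open>m\<close>, so the variance is one more instance of the transfer.\<close>
        have outer: "(\<lambda>a. outer_product (a - m) (a - m)) \<in> borel_measurable borel" for m :: "real^'n"
          by (intro outer_product_measurable) auto
        show "?P \<zeta>"
          unfolding evidence
          using lik_int pos integrable_iff[of "\<lambda>a. a"] integral_eq[of "\<lambda>a. a"]
            integrable_iff[OF outer] integral_eq[OF outer]
          by (simp add: cond_mean_def[of pxz \<zeta>, symmetric] cond_variance_def[of pxz \<zeta>])
      qed
    qed
  qed
qed

end
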